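(* Let $f$ be an atomic function for NPDo on a neighborhood $\mathrm{St}_\delta(k,n)$ of $\mathrm{St}(k,n)$, with subset $\mathbb{P}\subseteq\mathrm{St}(k,n)$ and constants $\alpha>0$, $\beta\ge0$, $\gamma=\alpha+\beta$. Then the NPDo Ansatz holds for $f$ (with the same $\mathbb{P}$) with $\omega=1/\alpha$.
   Context: $\mathrm{St}(k,n)=\{P\in\mathbb{R}^{n\times k}: P^{\mathrm T}P=I_k\}$, $1\le k\le n$; $\mathrm{St}_\delta(k,n)=\{P\in\mathbb{R}^{n\times k}:\|P^{\mathrm T}P-I_k\|<\delta\}$ for some $\delta>0$ and some matrix norm. $\mathcal{H}(P)=\partial f(P)/\partial P$ is the $n\times k$ matrix of partial derivatives with all entries of $P$ treated as independent. Atomic function for NPDo: a differentiable function $f:\mathrm{St}_\delta(k,n)\to\mathbb{R}$ for which there are a subset $\mathbb{P}\subseteq\mathrm{St}(k,n)$ and constants $\alpha>0$, $\beta\ge 0$, $\gamma=\alpha+\beta$ such that (1) $\mathrm{tr}\big(P^{\mathrm T}\frac{\partial f(P)}{\partial P}\big)=\gamma f(P)$ for all $P\in\mathbb{P}$; and (2) given $P\in\mathbb{P}$ and $\widehat P\in\mathrm{St}(k,n)$, there exists $Q\in\mathrm{St}(k,k)$ such that $\widetilde P=\widehat PQ\in\mathbb{P}$ and $\mathrm{tr}\big(\widehat P^{\mathrm T}\frac{\partial f(P)}{\partial P}\big)\le\alpha f(\widetilde P)+\beta f(P)$. NPDo Ansatz with constant $\omega>0$ (for $f$ with $\mathbb{P}$):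 whenever $P\in\mathbb{P}$, $\widehat P\in\mathrm{St}(k,n)$ and $\eta\in\mathbb{R}$ satisfy $\mathrm{tr}(\widehat P^{\mathrm T}\mathcal{H}(P))\ge \mathrm{tr}(P^{\mathrm T}\mathcal{H}(P))+\eta$, there exists $Q\in\mathrm{St}(k,k)$ such that $\widetilde P=\widehat PQ\in\mathbb{P}$ and $f(\widetilde P)\ge f(P)+\omega\eta$. *)

theory Defs
  imports "HOL-Analysis.Analysis"
begin

text \<open>
  Real \<open>n \<times> k\<close> matrices are elements of \<^typ>\<open>real ^ 'k ^ 'n\<close>, with \<open>n = CARD('n)\<close> and
  \<open>k = CARD('k)\<close>. In particular, \<open>St(k,k)\<close> is the instance \<^typ>\<open>(real ^ 'k ^ 'k) set\<close> of the
  constant below.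
\<close>

definition Stiefel :: "(real ^ 'k ^ 'n) set" where
  "Stiefel = {P. transpose P ** P = mat 1}"

text \<open>
  Only the norm axioms on the space of matrices are required; submultiplicative norms are thereby
  included.
\<close>

definition matrix_norm :: "(real ^ 'k ^ 'm \<Rightarrow> real) \<Rightarrow> bool" where
  "matrix_norm N \<longleftrightarrow>
     (\<forall>A. 0 \<le> N A) \<and>
     (\<forall>A. N A = 0 \<longleftrightarrow> A = 0) \<and>
     (\<forall>c A. N (c *\<^sub>R A) = \<bar>c\<bar> * N A) \<and>
     (\<forall>A B. N (A + B) \<le> N A + N B)"

definition Stiefel_nbhd :: "(real ^ 'k ^ 'k \<Rightarrow> real) \<Rightarrow> real \<Rightarrow> (real ^ 'k ^ 'n) set" where
  "Stiefel_nbhd N \<delta> = {P. N (transpose P ** P - mat 1) < \<delta>}"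

text \<open>
  The \<open>(i, j)\<close> entry is the partial derivative of \<open>f\<close> with respect to the \<open>(i, j)\<close> entry of \<open>P\<close>;
  \<open>axis i (axis j 1)\<close> is the matrix unit with its 1 in row \<open>i\<close> and column \<open>j\<close>.
\<close>

definition matrix_deriv :: "(real ^ 'k ^ 'n \<Rightarrow> real) \<Rightarrow> real ^ 'k ^ 'n \<Rightarrow> real ^ 'k ^ 'n" where
  "matrix_deriv f P = (\<chi> i j. deriv (\<lambda>t. f (P + t *\<^sub>R axis i (axis j 1))) 0)"

text \<open>
  A function on the neighbourhood is a total function whose values elsewhere are irrelevant: the
  neighbourhood is open, so they affect neither differentiability on it nor the partial
  derivatives at its points.
\<close>

definition NPDo_atomic ::
  "(real ^ 'k ^ 'k \<Rightarrow> real) \<Rightarrow> real \<Rightarrow> (real ^ 'k ^ 'n \<Rightarrow> real) \<Rightarrow> (real ^ 'k ^ 'n) set \<Rightarrow>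
    real \<Rightarrow> real \<Rightarrow> real \<Rightarrow> bool" where
  "NPDo_atomic N \<delta> f \<P> \<alpha> \<beta> \<gamma> \<longleftrightarrow>
     matrix_norm N \<and> \<delta> > 0 \<and> f differentiable_on Stiefel_nbhd N \<delta> \<and>
     \<P> \<subseteq> Stiefel \<and> \<alpha> > 0 \<and> \<beta> \<ge> 0 \<and> \<gamma> = \<alpha> + \<beta> \<and>
     (\<forall>P\<in>\<P>. trace (transpose P ** matrix_deriv f P) = \<gamma> * f P) \<and>
     (\<forall>P\<in>\<P>. \<forall>P'\<in>Stiefel. \<exists>Q\<in>(Stiefel :: (real ^ 'k ^ 'k) set).
        P' ** Q \<in> \<P> \<and>
        trace (transpose P' ** matrix_deriv f P) \<le> \<alpha> * f (P' ** Q) + \<beta> * f P)"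

definition NPDo_Ansatz ::
  "(real ^ 'k ^ 'n \<Rightarrow> real) \<Rightarrow> (real ^ 'k ^ 'n) set \<Rightarrow> real \<Rightarrow> bool" where
  "NPDo_Ansatz f \<P> \<omega> \<longleftrightarrow>
     \<omega> > 0 \<and>
     (\<forall>P\<in>\<P>. \<forall>P'\<in>Stiefel. \<forall>\<eta>.
        trace (transpose P' ** matrix_deriv f P) \<ge> trace (transpose P ** matrix_deriv f P) + \<eta> \<longrightarrow>
        (\<exists>Q\<in>(Stiefel :: (real ^ 'k ^ 'k) set).
           P' ** Q \<in> \<P> \<and> f (P' ** Q) \<ge> f P + \<omega> * \<eta>))"

end

theory Submission
  imports Defs
begin

text \<open>The rotation \<open>Q\<close> that condition (2) supplies for \<open>P\<close> and
  \<open>P'\<close> already serves the Ansatz, whatever \<eta> is. Writing H for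
  \<open>matrix_deriv f P\<close>, the trace of P'^T H is bounded below by \<gamma> f(P) + \<eta>,
  through the Ansatz premise and condition (1), and above by \<alpha> f(P'Q) + \<beta> f(P).
  Comparing the two bounds gives the claimed increase of f.\<close>

theorem theorem4p2:
  fixes f :: "real ^ 'k ^ 'n \<Rightarrow> real"
    and N :: "real ^ 'k ^ 'k \<Rightarrow> real"
    and \<P> :: "(real ^ 'k ^ 'n) set"
    and \<delta> \<alpha> \<beta> \<gamma> :: real
  assumes "CARD('k) \<le> CARD('n)"
    and "NPDo_atomic N \<delta> f \<P> \<alpha> \<beta> \<gamma>"
  shows "NPDo_Ansatz f \<P> (1 / \<alpha>)"
proof -
  have \<alpha>: "\<alpha> > 0" and \<gamma>: "\<gamma> = \<alpha> + \<beta>"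
    and eq: "\<And>P. P \<in> \<P> \<Longrightarrow> trace (transpose P ** matrix_deriv f P) = \<gamma> * f P"
    and ex: "\<And>P P'. P \<in> \<P> \<Longrightarrow> P' \<in> Stiefel \<Longrightarrow>
      \<exists>Q\<in>(Stiefel :: (real ^ 'k ^ 'k) set). P' ** Q \<in> \<P> \<and>
        trace (transpose P' ** matrix_deriv f P) \<le> \<alpha> * f (P' ** Q) + \<beta> * f P"
    using assms(2) unfolding NPDo_atomic_def by blast+
  show ?thesis
    unfolding NPDo_Ansatz_def
  proof (intro conjI ballI allI impI)
    show "1 / \<alpha> > 0"
      using \<alpha> by simp
  next
    fix P P' :: "real ^ 'k ^ 'n" and \<eta> :: real
    assume P: "P \<in> \<P>" and P': "P' \<in> Stiefel"
      and le: "trace (transpose P' ** matrix_deriv f P)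
        \<ge> trace (transpose P ** matrix_deriv f P) + \<eta>"
    obtain Q :: "real ^ 'k ^ 'k" where Q: "Q \<in> Stiefel" "P' ** Q \<in> \<P>"
      and upper: "trace (transpose P' ** matrix_deriv f P) \<le> \<alpha> * f (P' ** Q) + \<beta> * f P"
      using ex[OF P P'] by blast
    \<comment> \<open>Since \<gamma> = \<alpha> + \<beta>, the term \<open>\<beta> * f P\<close>
      occurs in both bounds and cancels.\<close>
    have "\<alpha> * f P + \<eta> \<le> \<alpha> * f (P' ** Q)"
      using le upper eq[OF P] by (simp add: \<gamma> distrib_right)
    \<comment> \<open>Division by \<alpha> > 0 keeps the inequality's direction; this is the source
      of \<omega> = 1 / \<alpha>.\<close>
    then have "f P + 1 / \<alpha> * \<eta> \<le> f (P' ** Q)"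
      using \<alpha> by (simp add: field_simps)
    with Q show "\<exists>Q\<in>(Stiefel :: (real ^ 'k ^ 'k) set).
        P' ** Q \<in> \<P> \<and> f (P' ** Q) \<ge> f P + 1 / \<alpha> * \<eta>"
      by blast
  qed
qed

end
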